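(* The Petersen graph is total threshold colorable.
   Context: All graphs are finite, simple and undirected. A near-far-labeling of a graph $G$ is a pair $(N,F)$ with $N \subseteq E(G)$ and $F = E(G)\setminus N$. For integers $r \geq t$, an $(r,t)$-threshold-coloring of $G$ with respect to $(N,F)$ is a map $c: V(G) \to \{0,\ldots,r-1\}$ with $|c(u)-c(v)| \leq t$ for every $uv \in N$ and $|c(u)-c(v)| > t$ for every $uv \in F$. $G$ is total threshold colorable if there exist integers $r \geq t$ such that $G$ has an $(r,t)$-threshold-coloring with respect to every near-far-labeling. *)

theory Defs
  imports Main
begin

text \<open>A graph is given by its vertex set and its set of edges, an edge \<open>uv\<close> being the
  two-element set \<open>{u, v}\<close>.\<close>

definition simple_graph :: "'a set \<Rightarrow> 'a set set \<Rightarrow> bool" where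
  "simple_graph V E \<longleftrightarrow> finite V \<and> (\<forall>e\<in>E. e \<subseteq> V \<and> card e = 2)"

definition near_far_labeling :: "'a set set \<Rightarrow> 'a set set \<Rightarrow> 'a set set \<Rightarrow> bool" where
  "near_far_labeling E N F \<longleftrightarrow> N \<subseteq> E \<and> F = E - N"

definition threshold_coloring ::
    "'a set \<Rightarrow> 'a set set \<Rightarrow> 'a set set \<Rightarrow> int \<Rightarrow> int \<Rightarrow> ('a \<Rightarrow> int) \<Rightarrow> bool" where
  "threshold_coloring V N F r t c \<longleftrightarrow>
     (\<forall>v\<in>V. c v \<in> {0..r - 1}) \<and>
     (\<forall>u v. {u, v} \<in> N \<longrightarrow> \<bar>c u - c v\<bar> \<le> t) \<and>
     (\<forall>u v. {u, v} \<in> F \<longrightarrow> \<bar>c u - c v\<bar> > t)"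

text \<open>The pair \<open>(r, t)\<close> is chosen once for the graph, before the labeling. Negative \<open>t\<close> need
  not be excluded: if there is an edge, the labeling \<open>N = E\<close> forces \<open>t \<ge> 0\<close>.\<close>

definition total_threshold_colorable :: "'a set \<Rightarrow> 'a set set \<Rightarrow> bool" where
  "total_threshold_colorable V E \<longleftrightarrow>
     (\<exists>r t. r \<ge> t \<and>
       (\<forall>N F. near_far_labeling E N F \<longrightarrow> (\<exists>c. threshold_coloring V N F r t c)))"

text \<open>The Petersen graph as the Kneser graph \<open>K(5,2)\<close>: vertices are the two-element subsets
  of a five-element set, adjacent iff they are disjoint.\<close>

definition petersen_verts :: "nat set set" where
  "petersen_verts = {A. A \<subseteq> {..<5} \<and> card A = 2}"

definition petersen_edges :: "nat set set set" where
  "petersen_edges = {{A, B} | A B. A \<in> petersen_verts \<and> B \<in> petersen_verts \<and> A \<inter> B = {}}"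

lemma simple_graph_petersen: "simple_graph petersen_verts petersen_edges"
proof -
  have "finite petersen_verts"
    by (rule finite_subset[of _ "Pow {..<5}"]) (auto simp: petersen_verts_def)
  moreover have "e \<subseteq> petersen_verts \<and> card e = 2" if e: "e \<in> petersen_edges" for e
  proof -
    from e obtain A B where AB: "e = {A, B}" "A \<in> petersen_verts" "B \<in> petersen_verts" "A \<inter> B = {}"
      by (auto simp: petersen_edges_def)
    then have "A \<noteq> B"
      by (auto simp: petersen_verts_def)
    with AB show ?thesis by simp
  qed
  ultimately show ?thesis by (simp add: simple_graph_def)
qed

end

theory Submission imports Defs begin

text \<open>
  Take \<open>t = 5\<close> and \<open>r = 23\<close>. The vertices \<open>{0,k}\<close> are independent, and the other six induce a
  perfect matching. Colour these six first, with distinct colours in an interval of length \<open>2t\<close>: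
  then \<open>{0,k}\<close> can be coloured unless, among its three neighbours, the one with the median colour
  is odd, meaning that its label differs from both other labels. At most one neighbour of \<open>{0,k}\<close>
  is odd, so at most four of the six pairs in \<open>{1,2,3,4}\<close> are odd for some \<open>k\<close>. Let \<open>{s,a}\<close>
  be another one, let \<open>b, c\<close> be the other two points, and exchange them if necessary so that
  \<open>{s,b}\<close> is not odd for \<open>a\<close>. Colour \<open>{s,a}, {s,b}, {s,c}\<close> by \<open>8, 9, 10\<close> and each of their
  partners in \<open>{0,1,2}\<close> or \<open>{5,6,7}\<close> according to the label of the matching edge. The medians at
  \<open>a, b, c\<close> are then fine, and the order of the partners is still free enough to take care of \<open>s\<close>.
\<close>

text \<open>The colours near \<open>x\<close> form a window of length \<open>2 * t\<close>. As
  \<open>u\<close>, \<open>v\<close>, \<open>w\<close> span at most that length, sliding it cuts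
  them off one by one from either side, but it can neither miss nor catch the median alone.\<close>

lemma extend_to_three:
  fixes u v w t :: int
  assumes "u < v" "v < w" "0 \<le> u" "w \<le> 2 * t" "V = U \<or> V = W"
  shows "\<exists>x. - t - 1 \<le> x \<and> x \<le> 3 * t + 1 \<and>
    (\<bar>x - u\<bar> \<le> t \<longleftrightarrow> U) \<and> (\<bar>x - v\<bar> \<le> t \<longleftrightarrow> V) \<and> (\<bar>x - w\<bar> \<le> t \<longleftrightarrow> W)"
proof -
  consider "U" "V" "W" | "\<not> U" "\<not> V" "\<not> W" | "U" "V" "\<not> W" | "U" "\<not> V" "\<not> W"
    | "\<not> U" "V" "W" | "\<not> U" "\<not> V" "W"
    using assms(5) by blast
  then show ?thesis
  proof cases
    case 1 then show ?thesis using assms by (intro exI[of _ "w - t"]) auto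
  next
    case 2 then show ?thesis using assms by (intro exI[of _ "u - t - 1"]) auto
  next
    case 3 then show ?thesis using assms by (intro exI[of _ "v - t"]) auto
  next
    case 4 then show ?thesis using assms by (intro exI[of _ "u - t"]) auto
  next
    case 5 then show ?thesis using assms by (intro exI[of _ "v + t"]) auto
  next
    case 6 then show ?thesis using assms by (intro exI[of _ "w + t"]) auto
  qed
qed

text \<open>With threshold 5, the colours 5, 6, 7 are near each of 8, 9, 10 and the colours 0, 1, 2
  are far from each. So the label of a matching edge fixes only the group of the partner's colour,
  not its place there.\<close>

definition fits :: "bool \<Rightarrow> int \<Rightarrow> bool" where
  "fits n x \<longleftrightarrow> (if n then x \<in> {5..7} else x \<in> {0..2})"

text \<open>The first colour can always be made extremal: it is the largest of its group if at least two
  of the three colours are in the upper group, and the smallest of its group otherwise.\<close>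

lemma low_colors_extremal:
  "\<exists>u v w. fits l u \<and> fits m v \<and> fits n w \<and>
    (v < w \<and> (u < v \<or> w < u) \<or> w < v \<and> (u < w \<or> v < u))"
proof (cases "l \<and> m \<or> l \<and> n \<or> m \<and> n")
  case True
  let ?f = "\<lambda>q i. (if q then 5 else 0) + i :: int"
  show ?thesis
    by (rule exI[of _ "?f l 2"], rule exI[of _ "?f m 1"], rule exI[of _ "?f n 0"])
      (use True in \<open>auto simp: fits_def\<close>)
next
  case False
  let ?f = "\<lambda>q i. (if q then 5 else 0) + i :: int"
  show ?thesis
    by (rule exI[of _ "?f l 0"], rule exI[of _ "?f m 1"], rule exI[of _ "?f n 2"])
      (use False in \<open>auto simp: fits_def\<close>)
qed

lemma fits_range: "fits n x \<Longrightarrow> 0 \<le> x \<and> x \<le> 7"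
  by (auto simp: fits_def split: if_splits)

text \<open>Serves \<open>{0,s}\<close>, whose neighbours are the three partners. Two of
  \<open>U\<close>, \<open>V\<close>, \<open>W\<close> agree; giving the third neighbour an extremal
  colour puts the median in the agreeing pair.\<close>

lemma low_colors:
  "\<exists>u v w x. fits l u \<and> fits m v \<and> fits n w \<and> -6 \<le> x \<and> x \<le> 16 \<and>
    (\<bar>x - u\<bar> \<le> 5 \<longleftrightarrow> U) \<and> (\<bar>x - v\<bar> \<le> 5 \<longleftrightarrow> V) \<and> (\<bar>x - w\<bar> \<le> 5 \<longleftrightarrow> W)"
proof -
  have *: "\<exists>u v w x. fits l u \<and> fits m v \<and> fits n w \<and> -6 \<le> x \<and> x \<le> 16 \<and>
    (\<bar>x - u\<bar> \<le> 5 \<longleftrightarrow> U) \<and> (\<bar>x - v\<bar> \<le> 5 \<longleftrightarrow> V) \<and> (\<bar>x - w\<bar> \<le> 5 \<longleftrightarrow> V)" for l m n U V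
  proof -
    obtain u v w where f: "fits l u" "fits m v" "fits n w"
      and "v < w \<and> (u < v \<or> w < u) \<or> w < v \<and> (u < w \<or> v < u)"
      using low_colors_extremal[of l m n] by blast
    then consider "u < v" "v < w" | "v < w" "w < u" | "u < w" "w < v" | "w < v" "v < u"
      by blast
    then have "\<exists>x. -6 \<le> x \<and> x \<le> 16 \<and>
      (\<bar>x - u\<bar> \<le> 5 \<longleftrightarrow> U) \<and> (\<bar>x - v\<bar> \<le> 5 \<longleftrightarrow> V) \<and> (\<bar>x - w\<bar> \<le> 5 \<longleftrightarrow> V)"
    proof cases
      case 1 then show ?thesis
        using extend_to_three[of u v w 5 V U V] f[THEN fits_range] by simp
    next
      case 2 then show ?thesis
        using extend_to_three[of v w u 5 V V U] f[THEN fits_range] by (simp; metis)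
    next
      case 3 then show ?thesis
        using extend_to_three[of u w v 5 V U V] f[THEN fits_range] by (simp; metis)
    next
      case 4 then show ?thesis
        using extend_to_three[of w v u 5 V V U] f[THEN fits_range] by (simp; metis)
    qed
    with f show ?thesis by blast
  qed
  consider "V = W" | "U = W" | "U = V" by blast
  then show ?thesis
  proof cases
    case 1 then show ?thesis using *[of l m n U V] by simp
  next
    case 2 then show ?thesis using *[of m l n V U] by blast
  next
    case 3 then show ?thesis using *[of n l m W U] by blast
  qed
qed

text \<open>If one label differs from both others, these two agree, so at most one element is odd.
  Quantifying over all enumerations of \<open>S\<close> makes \<open>d\<close> independent of their
  order.\<close>

lemma odd_one_out:
  "\<exists>d. \<forall>x y z. {x, y, z} = S \<and> distinct [x, y, z] \<and> x \<noteq> d \<longrightarrow> L x = L y \<or> L x = (L z :: bool)"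
proof (cases "\<exists>p q r. S = {p, q, r} \<and> distinct [p, q, r]")
  case True
  then obtain p q r where S: "S = {p, q, r}" "distinct [p, q, r]" by blast
  define d where "d = (if L p = L q then r else if L p = L r then q else p)"
  have "L x = L y \<or> L x = L z" if "{x, y, z} = S" "distinct [x, y, z]" "x \<noteq> d" for x y z
  proof -
    have "x \<in> {p, q, r}" "p \<in> {x, y, z}" "q \<in> {x, y, z}" "r \<in> {x, y, z}"
      using that S by blast+
    with that(2,3) S(2) show ?thesis
      unfolding d_def by (auto split: if_splits)
  qed
  then show ?thesis by blast
qed blast

lemma petersen_verts_enum:
  assumes "{..<5} = {z, s, a, b, c}"
  shows "petersen_verts \<subseteq> {{z,s}, {z,a}, {z,b}, {z,c}, {s,a}, {s,b}, {s,c}, {b,c}, {a,c}, {a,b}}"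
proof
  fix A
  assume "A \<in> petersen_verts"
  then obtain x y where "A = {x, y}" "x \<noteq> y" "x \<in> {z, s, a, b, c}" "y \<in> {z, s, a, b, c}"
    unfolding petersen_verts_def assms by (auto simp: card_2_iff)
  then show "A \<in> {{z,s}, {z,a}, {z,b}, {z,c}, {s,a}, {s,b}, {s,c}, {b,c}, {a,c}, {a,b}}"
    by (elim insertE emptyE) (simp_all add: insert_commute)
qed

text \<open>Symmetry of \<open>R\<close> leaves fifteen edges: the matching and three at each
  \<open>{z,k}\<close>.\<close>

lemma petersen_edges_cases:
  assumes five: "{..<5} = {z, s, a, b, c}"
    and "{u, v} \<in> petersen_edges"
    and "\<And>u v. R u v \<Longrightarrow> R v u"
    and "R {s,a} {b,c}" "R {s,b} {a,c}" "R {s,c} {a,b}"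
    and "R {z,s} {b,c}" "R {z,s} {a,c}" "R {z,s} {a,b}"
    and "R {z,a} {b,c}" "R {z,a} {s,b}" "R {z,a} {s,c}"
    and "R {z,b} {s,a}" "R {z,b} {a,c}" "R {z,b} {s,c}"
    and "R {z,c} {s,a}" "R {z,c} {s,b}" "R {z,c} {a,b}"
  shows "R u v"
proof -
  let ?V = "{{z,s}, {z,a}, {z,b}, {z,c}, {s,a}, {s,b}, {s,c}, {b,c}, {a,c}, {a,b}}"
  have "u \<in> petersen_verts" "v \<in> petersen_verts" "u \<inter> v = {}"
    using assms(2) by (auto simp: petersen_edges_def doubleton_eq_iff)
  moreover have "\<forall>u \<in> ?V. \<forall>v \<in> ?V. u \<inter> v = {} \<longrightarrow> R u v"
    by (simp add: assms(4-) assms(4-)[THEN assms(3)])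
  ultimately show ?thesis
    using petersen_verts_enum[OF five] by (meson subsetD)
qed

text \<open>In the conclusion, \<open>d k\<close> is the neighbour of \<open>{0,k}\<close> that must not have the median colour.\<close>

lemma good_enumeration:
  fixes d :: "nat \<Rightarrow> nat set"
  shows "\<exists>s a b c. {..<5} = {0, s, a, b, c} \<and> distinct [0, s, a, b, c] \<and>
    {s,a} \<noteq> d b \<and> {s,a} \<noteq> d c \<and> {s,b} \<noteq> d a"
proof -
  let ?pairs = "{P. P \<subseteq> {1..4::nat} \<and> card P = 2}"
  have "card (d ` {1..4}) \<le> 4"
    using card_image_le[of "{1..4}" d] by simp
  moreover have "card ?pairs = 6"
    using n_subsets[of "{1..4::nat}" 2] by (simp add: numeral_eq_Suc)
  ultimately have "\<not> ?pairs \<subseteq> d ` {1..4}"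
    using card_mono[of "d ` {1..4}" ?pairs] by auto
  then obtain P where P: "P \<subseteq> {1..4}" "card P = 2" "P \<notin> d ` {1..4}" by blast
  then obtain s a where sa: "{s, a} \<subseteq> {1..4}" "s \<noteq> a" "{s, a} \<notin> d ` {1..4}"
    by (metis card_2_iff)
  have "card ({1..4} - {s, a}) = 2"
    using sa by (simp add: card_Diff_subset)
  then obtain b c where bc: "{1..4} - {s, a} = {b, c}" "b \<noteq> c"
    by (auto simp: card_2_iff)
  have four: "{1..4} = {s, a, b, c}" and dist: "distinct [s, a, b, c]"
    using sa bc by auto
  have "{..<5} = insert 0 {1..4::nat}" by auto
  then have five: "{..<5} = {0, s, a, b, c}" "{..<5} = {0, s, a, c, b}"
    unfolding four by (simp_all add: insert_commute)
  have "0 \<notin> {1..4::nat}" by simp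
  then have dist: "distinct [0, s, a, b, c]" "distinct [0, s, a, c, b]"
    using dist unfolding four by auto
  have "b \<in> {1..4}" "c \<in> {1..4}" unfolding four by simp_all
  then have "{s, a} \<noteq> d b" "{s, a} \<noteq> d c"
    using sa(3) by blast+
  moreover have "{s, b} \<noteq> {s, c}"
    using bc(2) by (auto simp: doubleton_eq_iff)
  \<comment> \<open>If \<open>d a\<close> is \<open>{s,b}\<close>, it is not \<open>{s,c}\<close>,
    so exchanging \<open>b\<close> and \<open>c\<close> helps.\<close>
  ultimately show ?thesis
    using five dist by metis
qed

theorem theorem3: "total_threshold_colorable petersen_verts petersen_edges"
proof -
  have "\<exists>f. threshold_coloring petersen_verts N F 23 5 f"
    if NF: "near_far_labeling petersen_edges N F" for N F
  proof -
    define L where "L u v \<longleftrightarrow> {u, v} \<in> N" for u v :: "nat set"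
    \<comment> \<open>For \<open>k\<close> in \<open>{1..4}\<close> these pairs are the neighbours
      of \<open>{0,k}\<close>; for other \<open>k\<close> there are six pairs and the claim is
      vacuous.\<close>
    have "\<forall>k. \<exists>d. \<forall>p q r.
        {p, q, r} = {P. P \<subseteq> {1..4} - {k} \<and> card P = 2} \<and> distinct [p, q, r] \<and> p \<noteq> d \<longrightarrow>
        L {0,k} p = L {0,k} q \<or> L {0,k} p = L {0,k} r"
      by (intro allI odd_one_out)
    from choice[OF this] obtain d where "\<forall>k p q r.
        {p, q, r} = {P. P \<subseteq> {1..4} - {k} \<and> card P = 2} \<and> distinct [p, q, r] \<and> p \<noteq> d k \<longrightarrow>
        L {0,k} p = L {0,k} q \<or> L {0,k} p = L {0,k} r" ..
    note d = this[rule_format, OF conjI, OF _ conjI]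
    obtain s a b c where five: "{..<5} = {0, s, a, b, c}" and dist: "distinct [0, s, a, b, c]"
      and sel: "{s,a} \<noteq> d b" "{s,a} \<noteq> d c" "{s,b} \<noteq> d a"
      using good_enumeration[of d] by blast
    have "{1..4} = {..<5} - {0::nat}" by auto
    then have four: "{1..4} = {s, a, b, c}"
      unfolding five using dist by auto
    have nbrs: "{{x,y}, {x,w}, {y,w}} = {P. P \<subseteq> {1..4} - {k} \<and> card P = 2}"
      if "{1..4} - {k} = {x, y, w}" "distinct [x, y, w]" for k x y w :: nat
      unfolding that(1) using that(2) by (auto simp: card_2_iff doubleton_eq_iff)
    have "{1..4} - {b} = {s, a, c}" "{1..4} - {c} = {s, a, b}" "{1..4} - {a} = {s, b, c}"
      unfolding four using dist by auto
    note triples = this[THEN nbrs]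
    have neq: "{s,a} \<noteq> {s,b}" "{s,a} \<noteq> {s,c}" "{s,b} \<noteq> {s,c}"
        "{s,a} \<noteq> {a,b}" "{s,a} \<noteq> {a,c}" "{s,b} \<noteq> {a,b}" "{s,b} \<noteq> {b,c}"
        "{s,c} \<noteq> {a,c}" "{s,c} \<noteq> {b,c}"
      using dist by (simp_all add: doubleton_eq_iff)
    have med: "L {0,b} {s,a} = L {0,b} {s,c} \<or> L {0,b} {s,a} = L {0,b} {a,c}"
      by (rule d[OF triples(1) _ sel(1)]) (use dist neq in simp_all)
    have med': "L {0,c} {s,a} = L {0,c} {s,b} \<or> L {0,c} {s,a} = L {0,c} {a,b}"
      by (rule d[OF triples(2) _ sel(2)]) (use dist neq in simp_all)
    have med'': "L {0,a} {s,b} = L {0,a} {s,c} \<or> L {0,a} {s,b} = L {0,a} {b,c}"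
      by (rule d[OF triples(3) _ sel(3)]) (use dist neq in simp_all)
    obtain la lb lc xs where low: "fits (L {s,a} {b,c}) la" "fits (L {s,b} {a,c}) lb"
        "fits (L {s,c} {a,b}) lc"
      and xs: "-6 \<le> xs" "xs \<le> 16" "\<bar>xs - la\<bar> \<le> 5 \<longleftrightarrow> L {0,s} {b,c}"
        "\<bar>xs - lb\<bar> \<le> 5 \<longleftrightarrow> L {0,s} {a,c}" "\<bar>xs - lc\<bar> \<le> 5 \<longleftrightarrow> L {0,s} {a,b}"
      using low_colors by blast
    note range = low[THEN fits_range]
    \<comment> \<open>As \<open>la\<close>, \<open>lb\<close>, \<open>lc\<close> are at most 7, the
      median at \<open>{0,a}\<close> is 9, the colour of \<open>{s,b}\<close>; at
      \<open>{0,b}\<close> and \<open>{0,c}\<close> it is 8, the colour of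
      \<open>{s,a}\<close>.\<close>
    obtain xa where xa: "-6 \<le> xa" "xa \<le> 16" "\<bar>xa - la\<bar> \<le> 5 \<longleftrightarrow> L {0,a} {b,c}"
        "\<bar>xa - 9\<bar> \<le> 5 \<longleftrightarrow> L {0,a} {s,b}" "\<bar>xa - 10\<bar> \<le> 5 \<longleftrightarrow> L {0,a} {s,c}"
      using extend_to_three[of la 9 10 5 "L {0,a} {s,b}" "L {0,a} {b,c}" "L {0,a} {s,c}"] med'' range by auto
    obtain xb where xb: "-6 \<le> xb" "xb \<le> 16" "\<bar>xb - lb\<bar> \<le> 5 \<longleftrightarrow> L {0,b} {a,c}"
        "\<bar>xb - 8\<bar> \<le> 5 \<longleftrightarrow> L {0,b} {s,a}" "\<bar>xb - 10\<bar> \<le> 5 \<longleftrightarrow> L {0,b} {s,c}"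
      using extend_to_three[of lb 8 10 5 "L {0,b} {s,a}" "L {0,b} {a,c}" "L {0,b} {s,c}"] med range by auto
    obtain xc where xc: "-6 \<le> xc" "xc \<le> 16" "\<bar>xc - lc\<bar> \<le> 5 \<longleftrightarrow> L {0,c} {a,b}"
        "\<bar>xc - 8\<bar> \<le> 5 \<longleftrightarrow> L {0,c} {s,a}" "\<bar>xc - 9\<bar> \<le> 5 \<longleftrightarrow> L {0,c} {s,b}"
      using extend_to_three[of lc 8 9 5 "L {0,c} {s,a}" "L {0,c} {a,b}" "L {0,c} {s,b}"] med' range by auto
    define f where "f = (\<lambda>_. 0)({0,s} := xs, {0,a} := xa, {0,b} := xb, {0,c} := xc,
      {s,a} := 8, {s,b} := 9, {s,c} := 10, {b,c} := la, {a,c} := lb, {a,b} := lc)"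
    have f: "f {0,s} = xs" "f {0,a} = xa" "f {0,b} = xb" "f {0,c} = xc"
      "f {s,a} = 8" "f {s,b} = 9" "f {s,c} = 10" "f {b,c} = la" "f {a,c} = lb" "f {a,b} = lc"
      using dist unfolding f_def by (simp_all add: doubleton_eq_iff)
    have bounds: "-6 \<le> f v \<and> f v \<le> 16" for v
      using xs xa xb xc range unfolding f_def by auto
    have match: "\<bar>f {s,a} - f {b,c}\<bar> \<le> 5 \<longleftrightarrow> L {s,a} {b,c}"
      "\<bar>f {s,b} - f {a,c}\<bar> \<le> 5 \<longleftrightarrow> L {s,b} {a,c}" "\<bar>f {s,c} - f {a,b}\<bar> \<le> 5 \<longleftrightarrow> L {s,c} {a,b}"
      using low unfolding f fits_def by (auto split: if_splits)
    have edge: "\<bar>f u - f v\<bar> \<le> 5 \<longleftrightarrow> L u v" if "{u, v} \<in> petersen_edges" for u v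
      by (rule petersen_edges_cases[OF five that])
        (simp add: L_def abs_minus_commute insert_commute,
          simp_all only: f match[unfolded f] xs xa xb xc)
    \<comment> \<open>The shift by 6 moves the range from -6 to 16 onto 0 to 22, hence 23
      colours.\<close>
    have "threshold_coloring petersen_verts N F 23 5 (\<lambda>v. f v + 6)"
      unfolding threshold_coloring_def
    proof (intro conjI ballI allI impI)
      fix v
      show "f v + 6 \<in> {0..23 - 1}"
        using bounds[of v] by simp
    next
      fix u v
      assume "{u, v} \<in> N"
      then have "{u, v} \<in> petersen_edges" "L u v"
        using NF by (auto simp: near_far_labeling_def L_def)
      then show "\<bar>(f u + 6) - (f v + 6)\<bar> \<le> 5"
        using edge by simp
    next
      fix u v
      assume "{u, v} \<in> F"
      then have "{u, v} \<in> petersen_edges" "\<not> L u v"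
        using NF by (auto simp: near_far_labeling_def L_def)
      then show "\<bar>(f u + 6) - (f v + 6)\<bar> > 5"
        using edge[of u v] by simp
    qed
    then show ?thesis by blast
  qed
  then show ?thesis
    unfolding total_threshold_colorable_def
    by (intro exI[of _ 23] exI[of _ 5]) auto
qed

end
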